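(* Let $\mathcal A$ be the ring of integer matrices with rows and columns indexed by the positive integers such that each row has only finitely many nonzero entries. Let $B\in\mathcal A$ be given by $B_{ij}=\binom{i-1}{j-1}$ (with $\binom{a}{b}=0$ if $a<b$); its inverse is $(B^{-1})_{ij}=(-1)^{i+j}\binom{i-1}{j-1}$, also in $\mathcal A$. For $A\in\mathcal A$ and $n\ge1$ define the statistic $\tau_{A,n}=\sum_{k\ge1}A_{kn}\tau_k$ on $\mathfrak S(1243,2143)$, the generating function $$F_A(\mathbf q)=\sum_{\pi\in\mathfrak S(1243,2143)}\prod_{k\ge1}q_k^{\tau_{A,k}(\pi)},$$ and the continued fraction $$C_A(\mathbf q)=1+\cfrac{M_1}{1-M_1-\cfrac{M_2}{1-M_2-\cfrac{M_3}{1-M_3-\cdots}}},\qquad M_i=\prod_{k\ge1}q_k^{A_{ik}},$$ where $q_1,q_2,\dots$ are indeterminates. Then for every $A\in\mathcal A$, $F_A(\mathbf q)=C_{BA}(\mathbf q)$ and $C_A(\mathbf q)=F_{B^{-1}A}(\mathbf q)$ (as formal identities). Consequently, the Schröder continued fractions (continued fractions of the form $1+\frac{m_0}{1-m_0-\frac{m_1}{1-m_1-\cdots}}$ with each $m_i$ a monic monomial in given variables) are exactly the generating functions of countable families of statistics on $\mathfrak S(1243,2143)$ in which each statistic is a (possibly infinite) integer linear combination of the $\tau_k$ and each $\tau_k$ occurs in only finitely many of the statistics.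
   Context: A permutation avoids a pattern $\sigma$ if it has no subsequence with the same relative order as $\sigma$; $\mathfrak S(1243,2143)$ is the set of all permutations (of all lengths, including the empty one) avoiding both $1243$ and $2143$. For a permutation $\pi$ and $k\ge1$, $\tau_k(\pi)$ is the number of increasing subsequences of length $k$ in $\pi$. *)

theory Defs
  imports Main "HOL-Library.Equipollence"
begin

definition is_perm :: "nat list \<Rightarrow> bool" where
  "is_perm \<pi> \<longleftrightarrow> distinct \<pi> \<and> set \<pi> = {1..length \<pi>}"

definition contains :: "nat list \<Rightarrow> nat list \<Rightarrow> bool" where
  "contains \<pi> \<sigma> \<longleftrightarrow> (\<exists>idx :: nat list.
      length idx = length \<sigma> \<and> sorted_wrt (<) idx \<and> (\<forall>j<length idx. idx ! j < length \<pi>) \<and>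
      (\<forall>a<length \<sigma>. \<forall>b<length \<sigma>. (\<sigma> ! a < \<sigma> ! b \<longleftrightarrow> \<pi> ! (idx ! a) < \<pi> ! (idx ! b))))"

definition avoids :: "nat list \<Rightarrow> nat list \<Rightarrow> bool" where
  "avoids \<pi> \<sigma> \<longleftrightarrow> \<not> contains \<pi> \<sigma>"

definition Av :: "nat list set" where
  "Av = {\<pi>. is_perm \<pi> \<and> avoids \<pi> [1,2,4,3] \<and> avoids \<pi> [2,1,4,3]}"

definition tau :: "nat \<Rightarrow> nat list \<Rightarrow> nat" where
  "tau k \<pi> = card {S. S \<subseteq> {..<length \<pi>} \<and> card S = k \<and>
                        (\<forall>i\<in>S. \<forall>j\<in>S. i < j \<longrightarrow> \<pi> ! i < \<pi> ! j)}"

text \<open>Matrices are functions \<open>nat \<Rightarrow> nat \<Rightarrow> int\<close>; only indices \<open>\<ge> 1\<close> are meaningful,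
  entries with an index 0 are ignored by all constructions below.\<close>
definition matA :: "(nat \<Rightarrow> nat \<Rightarrow> int) set" where
  "matA = {A. \<forall>i\<ge>1. finite {j. j \<ge> 1 \<and> A i j \<noteq> 0}}"

definition mat_mult :: "(nat \<Rightarrow> nat \<Rightarrow> int) \<Rightarrow> (nat \<Rightarrow> nat \<Rightarrow> int) \<Rightarrow> (nat \<Rightarrow> nat \<Rightarrow> int)" where
  "mat_mult X Y = (\<lambda>i n. \<Sum>k\<in>{k. k \<ge> 1 \<and> X i k \<noteq> 0}. X i k * Y k n)"

definition Bmat :: "nat \<Rightarrow> nat \<Rightarrow> int" where
  "Bmat i j = int ((i - 1) choose (j - 1))"

definition Binv :: "nat \<Rightarrow> nat \<Rightarrow> int" where
  "Binv i j = (-1) ^ (i + j) * int ((i - 1) choose (j - 1))"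

text \<open>A Laurent monomial \<open>\<Prod>_{n\<ge>1} q_n^{e_n}\<close> is represented by its exponent vector
  \<open>e :: nat \<Rightarrow> int\<close> (with \<open>e 0 = 0\<close>).  A formal generating function that is a sum of
  monomials indexed by a set of objects is represented by its set of objects together with
  the weight (exponent vector) of each object; two such sums are equal as formal
  identities when, for every monomial, the sets of objects contributing that monomial are
  in bijection (equal, possibly infinite, coefficients).\<close>
definition formal_eq :: "'a set \<Rightarrow> ('a \<Rightarrow> nat \<Rightarrow> int) \<Rightarrow> 'b set \<Rightarrow> ('b \<Rightarrow> nat \<Rightarrow> int) \<Rightarrow> bool" where
  "formal_eq X w Y v \<longleftrightarrow> (\<forall>e. {x\<in>X. w x = e} \<approx> {y\<in>Y. v y = e})"

text \<open>\<open>F_A\<close>: the term of \<open>\<pi>\<close> is \<open>\<Prod>_n q_n^{\<tau>_{A,n}(\<pi>)}\<close> with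
  \<open>\<tau>_{A,n} = \<Sum>_{k\<ge>1} A_{kn} \<tau>_k\<close> (only \<open>k \<le> |\<pi>|\<close> contribute since \<open>\<tau>_k(\<pi>) = 0\<close> otherwise).\<close>
definition F_weight :: "(nat \<Rightarrow> nat \<Rightarrow> int) \<Rightarrow> nat list \<Rightarrow> nat \<Rightarrow> int" where
  "F_weight A \<pi> n = (if n = 0 then 0 else (\<Sum>k\<in>{1..length \<pi>}. A k n * int (tau k \<pi>)))"

text \<open>Expansion of the continued fraction.  Write \<open>S_h = 1/(1 - M_h - M_{h+1} S_{h+1})\<close>,
  so \<open>C = 1 + M_1 S_1\<close>.  Expanding \<open>S_h = \<Sum>_{r\<ge>0} (M_h + M_{h+1} S_{h+1})^r\<close>, a term of \<open>S_h\<close>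
  is a list of factors, each either \<open>M_h\<close> (\<open>Lev\<close>) or \<open>M_{h+1}\<close> times a term of \<open>S_{h+1}\<close>
  (\<open>Up t\<close>).  \<open>cf_mexp h t\<close> is the exponent vector in the formal variables \<open>M_1, M_2, \<dots>\<close>
  of such a term.\<close>
datatype cf_block = Lev | Up "cf_block list"

fun cf_mexp :: "nat \<Rightarrow> cf_block list \<Rightarrow> nat \<Rightarrow> nat" where
  "cf_mexp h [] = (\<lambda>_. 0)"
| "cf_mexp h (Lev # bs) = (\<lambda>i. (if i = h then 1 else 0) + cf_mexp h bs i)"
| "cf_mexp h (Up t # bs) = (\<lambda>i. (if i = Suc h then 1 else 0) + cf_mexp (Suc h) t i + cf_mexp h bs i)"

text \<open>Terms of \<open>C = 1 + M_1 S_1\<close>: \<open>None\<close> is the term 1, \<open>Some t\<close> is \<open>M_1\<close> times term \<open>t\<close> of \<open>S_1\<close>.\<close>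
definition C_mexp :: "cf_block list option \<Rightarrow> nat \<Rightarrow> nat" where
  "C_mexp x = (case x of None \<Rightarrow> (\<lambda>_. 0)
                | Some t \<Rightarrow> (\<lambda>i. (if i = 1 then 1 else 0) + cf_mexp 1 t i))"

text \<open>Substituting \<open>M_i = \<Prod>_k q_k^{A_{ik}}\<close>: the q-exponent vector of a term.\<close>
definition C_weight :: "(nat \<Rightarrow> nat \<Rightarrow> int) \<Rightarrow> cf_block list option \<Rightarrow> nat \<Rightarrow> int" where
  "C_weight A x n = (if n = 0 then 0 else
      (\<Sum>i\<in>{i. i \<ge> 1 \<and> C_mexp x i \<noteq> 0}. int (C_mexp x i) * A i n))"

definition F_eq_C :: "(nat \<Rightarrow> nat \<Rightarrow> int) \<Rightarrow> (nat \<Rightarrow> nat \<Rightarrow> int) \<Rightarrow> bool" where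
  "F_eq_C A A' \<longleftrightarrow> formal_eq Av (F_weight A) UNIV (C_weight A')"

end

theory Submission
  imports Defs
begin

text \<open>
  A permutation avoids 1243 and 2143 iff, for any two of its entries, the entries above and to the
  right of both are increasing. Write \<open>R(x)\<close> for the entries above and to the right of \<open>x\<close>.
  If \<open>R(\<pi>\<^sub>1)\<close> is increasing, delete \<open>\<pi>\<^sub>1\<close>. Otherwise \<open>\<pi>\<^sub>1 < \<pi>\<^sub>2\<close> and \<open>R(\<pi>\<^sub>2)\<close> is increasing; delete
  \<open>\<pi>\<^sub>2\<close>, whose only smaller predecessor is \<open>\<pi>\<^sub>1\<close>. In both cases the entries comparable with the
  deleted one form, together with it, a chain of some length \<open>l\<close>, so that \<open>\<tau>\<^sub>k\<close> drops by
  \<open>(l - 1) choose (k - 1)\<close>. In the resulting generating tree a permutation with label \<open>h\<close> has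
  children with labels \<open>1, 2, 2, \<dots>, h, h, h + 1\<close>. The terms of \<open>M\<^sub>1 S\<^sub>1\<close> form the same tree: a new
  block can be put at any height \<open>j \<le> h\<close> of the outermost spine, contributing \<open>M\<^sub>j\<close> or \<open>M\<^bsub>j+1\<^esub>\<close>.
  Hence \<open>\<tau>\<^sub>k\<close> is the sum of \<open>(l - 1) choose (k - 1)\<close> over the factors
  \<open>M\<^sub>l\<close> of the corresponding term.
\<close>

section \<open>Generating trees\<close>

text \<open>Words \<open>(j, u) # w\<close> encode nodes of the tree, last step first. A node of height \<open>d\<close> (label
  \<open>d + 1\<close>) has the children \<open>(j, u)\<close> with \<open>j \<le> d\<close>, of height \<open>j\<close> or \<open>j + 1\<close>.\<close>

fun height :: "(nat \<times> bool) list \<Rightarrow> nat" where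
  "height [] = 0"
| "height ((j, u) # w) = j + of_bool u"

fun valid :: "(nat \<times> bool) list \<Rightarrow> bool" where
  "valid [] = True"
| "valid ((j, u) # w) = (valid w \<and> j \<le> height w)"

definition build :: "'a \<Rightarrow> (nat \<Rightarrow> bool \<Rightarrow> 'a \<Rightarrow> 'a) \<Rightarrow> (nat \<times> bool) list \<Rightarrow> 'a" where
  "build root step w = foldr (\<lambda>(j, u). step j u) w root"

lemma build_simps [simp]:
  "build root step [] = root"
  "build root step ((j, u) # w) = step j u (build root step w)"
  by (simp_all add: build_def)

text \<open>Unique parents put words and nodes in bijection. Instantiating this for terms and for
  permutations matches the two without a direct map; \<open>sz\<close> makes the descent to the root
  terminate.\<close>

locale generating_tree =
  fixes X :: "'a set" and root :: 'a and step :: "nat \<Rightarrow> bool \<Rightarrow> 'a \<Rightarrow> 'a"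
    and d :: "'a \<Rightarrow> nat" and sz :: "'a \<Rightarrow> nat"
  assumes root: "root \<in> X" "d root = 0"
    and step: "x \<in> X \<Longrightarrow> j \<le> d x \<Longrightarrow> step j u x \<in> X \<and> d (step j u x) = j + of_bool u"
    and step_neq_root: "x \<in> X \<Longrightarrow> j \<le> d x \<Longrightarrow> step j u x \<noteq> root"
    and step_inj: "x \<in> X \<Longrightarrow> j \<le> d x \<Longrightarrow> x' \<in> X \<Longrightarrow> j' \<le> d x' \<Longrightarrow>
          step j u x = step j' u' x' \<Longrightarrow> j = j' \<and> u = u' \<and> x = x'"
    and parent: "x \<in> X \<Longrightarrow> x \<noteq> root \<Longrightarrow>
          \<exists>y j u. y \<in> X \<and> j \<le> d y \<and> x = step j u y \<and> sz y < sz x"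
begin

lemma build_in: "valid w \<Longrightarrow> build root step w \<in> X \<and> d (build root step w) = height w"
  by (induction w rule: valid.induct) (use root step in auto)

lemma build_inj:
  "valid w \<Longrightarrow> valid w' \<Longrightarrow> build root step w = build root step w' \<Longrightarrow> w = w'"
proof (induction w arbitrary: w' rule: valid.induct)
  case 1
  then show ?case
    by (cases w' rule: valid.cases) (use build_in step_neq_root in \<open>auto simp: eq_commute\<close>)
next
  case (2 j u w)
  then show ?case
  proof (cases w' rule: valid.cases)
    case 1
    with 2 show ?thesis
      using build_in[of w] step_neq_root by auto
  next
    case (2 j' u' v)
    then show ?thesis
      using "2.IH"[of v] "2.prems" build_in[of w] build_in[of v]
        step_inj[of "build root step w" j "build root step v" j' u u'] by auto
  qed
qed

lemma build_surj: "x \<in> X \<Longrightarrow> \<exists>w. valid w \<and> x = build root step w"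
proof (induction "sz x" arbitrary: x rule: less_induct)
  case less
  show ?case
  proof (cases "x = root")
    case True
    then show ?thesis by (intro exI[of _ "[]"]) simp
  next
    case False
    then obtain y j u where y: "y \<in> X" "j \<le> d y" "x = step j u y" "sz y < sz x"
      using parent less.prems by blast
    then obtain w where "valid w" "y = build root step w"
      using less.hyps by blast
    then show ?thesis
      using y build_in[of w] by (intro exI[of _ "(j, u) # w"]) auto
  qed
qed

lemma bij_betw_build: "bij_betw (build root step) {w. valid w} X"
  unfolding bij_betw_def inj_on_def using build_inj build_in build_surj by blast

end

text \<open>Each step contributes the label of the node it reaches. The final 1 belongs to the root:
  the leading factor \<open>M_1\<close> on one side, the permutation \<open>[1]\<close> on the
  other.\<close>

definition labels :: "(nat \<times> bool) list \<Rightarrow> nat list" where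
  "labels w = map (\<lambda>(j, u). Suc (j + of_bool u)) w @ [1]"

lemma labels_simps [simp]:
  "labels [] = [1]"
  "labels ((j, u) # w) = Suc (j + of_bool u) # labels w"
  by (simp_all add: labels_def)

lemma labels_ge_1: "l \<in> set (labels w) \<Longrightarrow> 1 \<le> l"
  by (auto simp: labels_def)

text \<open>A step raises the height by at most one. Thanks to this bound, sums over
  \<open>k\<close> up to the length of the permutation meet every nonzero binomial
  coefficient.\<close>

lemma labels_le_length:
  assumes "valid w"
  shows "height w < length (labels w)" "l \<in> set (labels w) \<Longrightarrow> l \<le> length (labels w)"
proof -
  have "height w < length (labels w) \<and> (\<forall>l \<in> set (labels w). l \<le> length (labels w))"
    using assms
  proof (induction w rule: valid.induct)
    case (2 j u w)
    then have "height w < length (labels w)" "\<forall>l \<in> set (labels w). l \<le> length (labels w)" "j \<le> height w"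
      by auto
    then show ?case by (cases u) auto
  qed simp
  then show "height w < length (labels w)" "l \<in> set (labels w) \<Longrightarrow> l \<le> length (labels w)"
    by auto
qed

section \<open>The tree of terms of the continued fraction\<close>

text \<open>The spine is followed by always entering the head block; a new block fits at the heights
  \<open>0\<close> to \<open>depth t\<close>.\<close>

fun depth :: "cf_block list \<Rightarrow> nat" where
  "depth [] = 0"
| "depth (Lev # r) = 0"
| "depth (Up t # r) = Suc (depth t)"

text \<open>Blocks are added at the head of the lists, so the word lists the blocks of a term from right
  to left; exponents do not see the order.\<close>

fun add_block :: "nat \<Rightarrow> bool \<Rightarrow> cf_block list \<Rightarrow> cf_block list" where
  "add_block 0 u t = (if u then Up [] else Lev) # t"
| "add_block (Suc j) u (Up t # r) = Up (add_block j u t) # r"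
| "add_block (Suc j) u t = t"

lemma add_block_neq_Nil: "j \<le> depth t \<Longrightarrow> add_block j u t \<noteq> []"
  by (induction j u t rule: add_block.induct) auto

lemma depth_add_block: "j \<le> depth t \<Longrightarrow> depth (add_block j u t) = j + of_bool u"
  by (induction j u t rule: add_block.induct) auto

text \<open>The head block decides: insertion at height 0 puts \<open>Lev\<close> or
  \<open>Up []\<close> there, deeper insertion leaves an \<open>Up\<close> with nonempty
  body.\<close>

lemma add_block_inj:
  "j \<le> depth t \<Longrightarrow> j' \<le> depth t' \<Longrightarrow> add_block j u t = add_block j' u' t' \<Longrightarrow>
     j = j' \<and> u = u' \<and> t = t'"
proof (induction j u t arbitrary: j' u' t' rule: add_block.induct)
  case (1 u t)
  show ?case
  proof (cases "(j', u', t')" rule: add_block.cases)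
    case (2 j'' u'' t'' r)
    with 1 show ?thesis using add_block_neq_Nil[of j'' t'' u''] by (auto split: if_splits)
  qed (use 1 in \<open>auto split: if_splits\<close>)
next
  case (2 j u t r)
  show ?case
  proof (cases "(j', u', t')" rule: add_block.cases)
    case (1 u'' t'')
    with 2 show ?thesis using add_block_neq_Nil[of j t u] by (auto split: if_splits)
  next
    case (2 j'' u'' t'' r'')
    with "2.prems" "2.IH"[of j'' t'' u''] show ?thesis by simp
  qed (use 2 in auto)
qed auto

text \<open>The block removed is the innermost one on the head spine, a \<open>Lev\<close> or an
  \<open>Up []\<close>.\<close>

lemma add_block_surj:
  "t \<noteq> [] \<Longrightarrow> \<exists>s j u. j \<le> depth s \<and> t = add_block j u s \<and> size_list size s < size_list size t"
proof (induction t rule: depth.induct)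
  case (2 r)
  show ?case by (intro exI[of _ r] exI[of _ 0] exI[of _ False]) simp
next
  case (3 t r)
  show ?case
  proof (cases "t = []")
    case True
    then show ?thesis by (intro exI[of _ r] exI[of _ 0] exI[of _ True]) simp
  next
    case False
    then obtain s j u where "j \<le> depth s" "t = add_block j u s" "size_list size s < size_list size t"
      using 3 by blast
    then show ?thesis
      by (intro exI[of _ "Up s # r"] exI[of _ "Suc j"] exI[of _ u]) simp
  qed
qed simp

interpretation cf: generating_tree UNIV "[]" add_block depth "size_list size"
  by unfold_locales (use add_block_surj in \<open>auto simp: depth_add_block add_block_neq_Nil dest: add_block_inj\<close>)

abbreviation cf_of :: "(nat \<times> bool) list \<Rightarrow> cf_block list" where
  "cf_of \<equiv> build [] add_block"

lemma cf_mexp_add_block: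
  "j \<le> depth t \<Longrightarrow> cf_mexp h (add_block j u t) i = of_bool (i = h + j + of_bool u) + cf_mexp h t i"
  by (induction j u t arbitrary: h rule: add_block.induct) auto

text \<open>Height 0 belongs to \<open>S_1\<close>, so a block at height \<open>j\<close>
  contributes \<open>M_(j+1)\<close> or \<open>M_(j+2)\<close>, whose index is the label of its
  step.\<close>

lemma C_mexp_cf_of: "valid w \<Longrightarrow> C_mexp (Some (cf_of w)) i = count_list (labels w) i"
  by (induction w rule: valid.induct) (use cf.build_in in \<open>auto simp: C_mexp_def cf_mexp_add_block\<close>)

lemma sum_count_list:
  fixes f :: "'b \<Rightarrow> int"
  assumes "finite S" "set xs \<subseteq> S"
  shows "(\<Sum>i\<in>S. int (count_list xs i) * f i) = (\<Sum>x\<leftarrow>xs. f x)"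
  using assms(2)
proof (induction xs)
  case (Cons x xs)
  have "(\<Sum>i\<in>S. int (count_list (x # xs) i) * f i)
      = (\<Sum>i\<in>S. (if i = x then f i else 0) + int (count_list xs i) * f i)"
    by (intro sum.cong) (auto simp: distrib_right)
  also have "\<dots> = f x + (\<Sum>i\<in>S. int (count_list xs i) * f i)"
    using Cons.prems assms(1) by (simp add: sum.distrib sum.delta)
  finally show ?case using Cons by simp
qed simp

lemma C_weight_cf_of:
  assumes "valid w" "n > 0"
  shows "C_weight A (Some (cf_of w)) n = (\<Sum>l\<leftarrow>labels w. A l n)"
proof -
  have "{i. i \<ge> 1 \<and> C_mexp (Some (cf_of w)) i \<noteq> 0} = set (labels w)"
    using labels_ge_1[of _ w] unfolding C_mexp_cf_of[OF assms(1)] count_list_0_iff by blast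
  then show ?thesis
    using assms by (simp add: C_weight_def C_mexp_cf_of sum_count_list)
qed

section \<open>The matrix B\<close>

lemma sum_supp_atLeast1:
  fixes f g :: "nat \<Rightarrow> int"
  assumes "\<And>k. k > l \<Longrightarrow> f k = 0"
  shows "(\<Sum>k\<in>{k. k \<ge> 1 \<and> f k \<noteq> 0}. f k * g k) = (\<Sum>k<l. f (Suc k) * g (Suc k))"
proof -
  have "(\<Sum>k\<in>{k. k \<ge> 1 \<and> f k \<noteq> 0}. f k * g k) = (\<Sum>k\<in>{Suc 0..l}. f k * g k)"
    by (rule sum.mono_neutral_left) (use assms in \<open>auto simp: not_less[symmetric]\<close>)
  then show ?thesis by (simp add: sum.atLeast1_atMost_eq)
qed

lemma mat_mult_Bmat:
  "mat_mult Bmat A (Suc l) n = (\<Sum>k\<le>l. int (l choose k) * A (Suc k) n)"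
  unfolding mat_mult_def
  by (subst sum_supp_atLeast1[where l = "Suc l"]) (auto simp: Bmat_def binomial_eq_0 lessThan_Suc_atMost)

lemma mat_mult_Binv:
  "mat_mult Binv A (Suc l) n = (\<Sum>k\<le>l. (-1) ^ (l + k) * int (l choose k) * A (Suc k) n)"
  unfolding mat_mult_def
  by (subst sum_supp_atLeast1[where l = "Suc l"]) (auto simp: Binv_def binomial_eq_0 lessThan_Suc_atMost)

text \<open>Rewriting the product of binomials as
  \<open>(l choose m) * ((l - m) choose (k - m))\<close> leaves an alternating row sum of Pascal's
  triangle, which vanishes unless \<open>m = l\<close>.\<close>

lemma choose_orthogonal:
  assumes "m \<le> l"
  shows "(\<Sum>k\<le>l. int (l choose k) * ((-1) ^ (k + m) * int (k choose m))) = of_bool (m = l)"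
proof -
  have "(\<Sum>k\<le>l. int (l choose k) * ((-1) ^ (k + m) * int (k choose m)))
      = (\<Sum>k\<in>{m..l}. int (l choose k) * ((-1) ^ (k + m) * int (k choose m)))"
    by (rule sum.mono_neutral_right) (auto simp: binomial_eq_0)
  also have "\<dots> = (\<Sum>i\<le>l - m. int (l choose (m + i)) * ((-1) ^ (m + i + m) * int ((m + i) choose m)))"
    using assms by (intro sum.reindex_bij_witness[of _ "\<lambda>i. m + i" "\<lambda>k. k - m"]) auto
  also have "\<dots> = (\<Sum>i\<le>l - m. int (l choose m) * ((-1) ^ i * int ((l - m) choose i)))"
  proof (rule sum.cong)
    fix i assume "i \<in> {..l - m}"
    then have "(l choose (m + i)) * ((m + i) choose m) = (l choose m) * ((l - m) choose i)"
      using choose_mult[of m "m + i" l] assms by simp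
    then have "int (l choose (m + i)) * int ((m + i) choose m) = int (l choose m) * int ((l - m) choose i)"
      by (metis of_nat_mult)
    moreover have "(-1) ^ (m + i + m) = ((-1) ^ i :: int)"
      by (simp add: power_add)
    ultimately show "int (l choose (m + i)) * ((-1) ^ (m + i + m) * int ((m + i) choose m))
        = int (l choose m) * ((-1) ^ i * int ((l - m) choose i))"
      by (simp add: algebra_simps)
  qed simp
  also have "\<dots> = of_bool (m = l)"
    using choose_alternating_sum[of "l - m", where 'a = int] assms
    by (cases "m = l") (auto simp flip: sum_distrib_left)
  finally show ?thesis .
qed

text \<open>Reduces the identity for \<open>B^-1 A\<close> to the one for
  \<open>B A\<close>.\<close>

lemma mat_mult_Bmat_Binv: "mat_mult Bmat (mat_mult Binv A) (Suc l) n = A (Suc l) n"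
proof -
  \<comment> \<open>Vanishing binomials extend the inner sum from \<open>m <= k\<close> to
    \<open>m <= l\<close>, so that the two sums can be exchanged.\<close>
  have "mat_mult Bmat (mat_mult Binv A) (Suc l) n
      = (\<Sum>k\<le>l. int (l choose k) * (\<Sum>m\<le>l. (-1) ^ (k + m) * int (k choose m) * A (Suc m) n))"
    unfolding mat_mult_Bmat mat_mult_Binv
    by (intro sum.cong refl arg_cong2[of _ _ _ _ "(*)"] sum.mono_neutral_left) (auto simp: binomial_eq_0)
  also have "\<dots> = (\<Sum>k\<le>l. \<Sum>m\<le>l. int (l choose k) * ((-1) ^ (k + m) * int (k choose m)) * A (Suc m) n)"
    by (simp add: sum_distrib_left mult.assoc)
  also have "\<dots> = (\<Sum>m\<le>l. (\<Sum>k\<le>l. int (l choose k) * ((-1) ^ (k + m) * int (k choose m))) * A (Suc m) n)"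
    by (subst sum.swap) (simp add: sum_distrib_right)
  also have "\<dots> = (\<Sum>m\<le>l. of_bool (m = l) * A (Suc m) n)"
    by (intro sum.cong refl) (simp add: choose_orthogonal)
  also have "\<dots> = A (Suc l) n"
    by (subst sum.remove[of _ l]) auto
  finally show ?thesis .
qed

text \<open>The support of a finite combination of rows lies in the union of their supports.\<close>

lemma matA_combination:
  assumes "A \<in> matA" and C: "\<And>l n. C (Suc l) n = (\<Sum>k\<le>l. c l k * A (Suc k) n)"
  shows "C \<in> matA"
  unfolding matA_def
proof (intro CollectI allI impI)
  fix i :: nat assume "1 \<le> i"
  then obtain l where i: "i = Suc l" by (cases i) auto
  have "{n. n \<ge> 1 \<and> C i n \<noteq> 0} \<subseteq> (\<Union>k\<le>l. {n. n \<ge> 1 \<and> A (Suc k) n \<noteq> 0})"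
    unfolding i C by (auto elim!: sum.not_neutral_contains_not_neutral)
  moreover have "finite (\<Union>k\<le>l. {n. n \<ge> 1 \<and> A (Suc k) n \<noteq> 0})"
    using assms(1) by (auto simp: matA_def)
  ultimately show "finite {n. n \<ge> 1 \<and> C i n \<noteq> 0}"
    by (rule finite_subset)
qed

section \<open>Pattern avoidance and increasing subsequences, recursively\<close>

text \<open>The lower bound \<open>lo\<close> carries the last chosen value through the recursion;
  for positive entries, \<open>lo = 0\<close> gives \<open>tau\<close>.\<close>

fun chains :: "nat \<Rightarrow> nat \<Rightarrow> nat list \<Rightarrow> nat" where
  "chains 0 lo xs = 1"
| "chains (Suc k) lo [] = 0"
| "chains (Suc k) lo (x # xs) = chains (Suc k) lo xs + (if lo < x then chains k x xs else 0)"

definition chain_sets :: "nat \<Rightarrow> nat \<Rightarrow> nat list \<Rightarrow> nat set set" where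
  "chain_sets k lo xs = {S. S \<subseteq> {..<length xs} \<and> card S = k \<and>
     (\<forall>i\<in>S. \<forall>j\<in>S. i < j \<longrightarrow> xs ! i < xs ! j) \<and> (\<forall>i\<in>S. lo < xs ! i)}"

lemma finite_chain_sets: "finite (chain_sets k lo xs)"
  by (rule finite_subset[of _ "Pow {..<length xs}"]) (auto simp: chain_sets_def)

lemma chain_sets_Cons:
  "chain_sets (Suc k) lo (x # xs) = (`) Suc ` chain_sets (Suc k) lo xs \<union>
     (if lo < x then (\<lambda>S. insert 0 (Suc ` S)) ` chain_sets k x xs else {})" (is "?L = ?R")
proof
  show "?R \<subseteq> ?L"
  proof
    fix S assume "S \<in> ?R"
    then consider T where "T \<in> chain_sets (Suc k) lo xs" "S = Suc ` T"
      | T where "lo < x" "T \<in> chain_sets k x xs" "S = insert 0 (Suc ` T)"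
      by (auto split: if_splits)
    then show "S \<in> ?L"
    proof cases
      case 1
      then show ?thesis by (auto simp: chain_sets_def card_image)
    next
      case 2
      then have "finite T" by (auto simp: chain_sets_def intro: finite_subset)
      with 2 show ?thesis by (fastforce simp: chain_sets_def card_image)
    qed
  qed
next
  show "?L \<subseteq> ?R"
  proof
    fix S assume S: "S \<in> ?L"
    define T where "T = {i. Suc i \<in> S}"
    have fin: "finite S" using S by (auto simp: chain_sets_def intro: finite_subset)
    have img: "Suc ` T = S - {0}"
      by (auto simp: T_def image_iff) (metis not0_implies_Suc)
    have cT: "card T = card (S - {0})"
      by (simp flip: img add: card_image)
    have T: "T \<subseteq> {..<length xs}" "\<forall>i\<in>T. \<forall>j\<in>T. i < j \<longrightarrow> xs ! i < xs ! j" "\<forall>i\<in>T. lo < xs ! i"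
      using S by (fastforce simp: chain_sets_def T_def)+
    show "S \<in> ?R"
    proof (cases "0 \<in> S")
      case False
      then have "T \<in> chain_sets (Suc k) lo xs"
        using S T cT by (simp add: chain_sets_def)
      with False img show ?thesis by auto
    next
      case True
      then have "lo < x" "\<forall>i\<in>T. x < xs ! i"
        using S by (fastforce simp: chain_sets_def T_def)+
      moreover from this have "T \<in> chain_sets k x xs"
        using S T cT True fin by (simp add: chain_sets_def)
      moreover have "S = insert 0 (Suc ` T)" using True img by auto
      ultimately show ?thesis by auto
    qed
  qed
qed

lemma card_chain_sets: "card (chain_sets k lo xs) = chains k lo xs"
proof (induction k lo xs rule: chains.induct)
  case (1 lo xs)
  have "chain_sets 0 lo xs = {{}}"
    by (auto simp: chain_sets_def dest: finite_subset[OF _ finite_lessThan])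
  then show ?case by simp
next
  case (2 k lo)
  have "chain_sets (Suc k) lo [] = {}" by (auto simp: chain_sets_def)
  then show ?case by simp
next
  case (3 k lo x xs)
  have inj: "inj_on ((`) Suc) A" "inj_on (\<lambda>S. insert 0 (Suc ` S)) A" for A
    by (auto simp: inj_on_def inj_image_eq_iff)
  have "((`) Suc ` chain_sets (Suc k) lo xs) \<inter> ((\<lambda>S. insert 0 (Suc ` S)) ` chain_sets k x xs) = {}"
    by auto
  then show ?case
    using 3 by (auto simp: chain_sets_Cons card_Un_disjoint finite_chain_sets card_image inj)
qed

lemma tau_eq_chains:
  assumes "\<forall>x\<in>set \<pi>. 0 < x"
  shows "tau k \<pi> = chains k 0 \<pi>"
proof -
  have "tau k \<pi> = card (chain_sets k 0 \<pi>)"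
    unfolding tau_def chain_sets_def using assms
    by (intro arg_cong[of _ _ card]) (auto simp: subset_iff)
  then show ?thesis by (simp add: card_chain_sets)
qed

lemma chains_map:
  assumes "strict_mono f"
  shows "chains k (f lo) (map f xs) = chains k lo xs"
  by (induction k lo xs rule: chains.induct) (auto simp: strict_mono_less[OF assms])

text \<open>Pascal's rule: the first entry above \<open>lo\<close> is below all later ones above
  \<open>lo\<close>, so choosing it leaves the same candidates as skipping it.\<close>

lemma chains_sorted:
  assumes "distinct xs" "sorted (filter (\<lambda>x. lo < x) xs)"
  shows "chains k lo xs = length (filter (\<lambda>x. lo < x) xs) choose k"
  using assms
proof (induction k lo xs rule: chains.induct)
  case (3 k lo x xs)
  show ?case
  proof (cases "lo < x")
    case True
    with 3 have "\<forall>y\<in>set xs. lo < y \<longrightarrow> x < y" by (auto simp: le_less)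
    with True have "filter (\<lambda>y. x < y) xs = filter (\<lambda>y. lo < y) xs"
      by (intro filter_cong) auto
    with 3 True show ?thesis by simp
  qed (use 3 in auto)
qed auto

section \<open>Avoidance of both patterns as one recursive condition\<close>

fun ok1 :: "nat \<Rightarrow> nat list \<Rightarrow> bool" where
  "ok1 x [] = True"
| "ok1 x (y # ys) = (ok1 x ys \<and> sorted (filter (\<lambda>z. max x y < z) ys))"

text \<open>The condition on pairs of entries is grouped by the first entry of the pair, which suits
  insertion at the front.\<close>

fun ok :: "nat list \<Rightarrow> bool" where
  "ok [] = True"
| "ok (x # xs) = (ok xs \<and> ok1 x xs)"

lemma sorted_filter_iff:
  "sorted (filter P xs) \<longleftrightarrow>
     (\<forall>c d. c < d \<longrightarrow> d < length xs \<longrightarrow> P (xs ! c) \<longrightarrow> P (xs ! d) \<longrightarrow> xs ! c \<le> (xs ! d :: nat))"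
proof (induction xs)
  case (Cons x xs)
  have "sorted (filter P (x # xs)) \<longleftrightarrow> (P x \<longrightarrow> (\<forall>d<length xs. P (xs ! d) \<longrightarrow> x \<le> xs ! d)) \<and> sorted (filter P xs)"
    by (auto simp: in_set_conv_nth)
  then show ?case unfolding Cons.IH
    by (auto simp: nth_Cons split: nat.split)
qed simp

lemma ok1_iff:
  "ok1 x xs \<longleftrightarrow> (\<forall>b c d. b < c \<longrightarrow> c < d \<longrightarrow> d < length xs \<longrightarrow>
     \<not> (x < xs ! d \<and> xs ! b < xs ! d \<and> xs ! d < xs ! c))" (is "_ \<longleftrightarrow> ?Q xs")
proof (induction xs)
  case (Cons y ys)
  have "?Q (y # ys) \<longleftrightarrow> ?Q ys \<and> (\<forall>c d. c < d \<longrightarrow> d < length ys \<longrightarrow>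
     \<not> (x < ys ! d \<and> y < ys ! d \<and> ys ! d < ys ! c))" (is "_ \<longleftrightarrow> _ \<and> ?R")
  proof (intro iffI conjI allI impI)
    fix b c d assume Q: "?Q (y # ys)" and "b < c" "c < d" "d < length ys"
    then show "\<not> (x < ys ! d \<and> ys ! b < ys ! d \<and> ys ! d < ys ! c)"
      using Q[rule_format, of "Suc b" "Suc c" "Suc d"] by simp
  next
    fix c d assume Q: "?Q (y # ys)" and "c < d" "d < length ys"
    then show "\<not> (x < ys ! d \<and> y < ys ! d \<and> ys ! d < ys ! c)"
      using Q[rule_format, of 0 "Suc c" "Suc d"] by simp
  next
    fix b c d assume QR: "?Q ys \<and> ?R" and *: "b < c" "c < d" "d < length (y # ys)"
    then obtain c' d' where "c = Suc c'" "d = Suc d'" by (metis less_nat_zero_code not0_implies_Suc)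
    with QR * show "\<not> (x < (y # ys) ! d \<and> (y # ys) ! b < (y # ys) ! d \<and> (y # ys) ! d < (y # ys) ! c)"
      by (cases b) auto
  qed
  moreover have "?R \<longleftrightarrow> sorted (filter (\<lambda>z. max x y < z) ys)"
    unfolding sorted_filter_iff by (intro iff_allI) auto
  ultimately show ?case unfolding ok1.simps Cons.IH by (simp only:)
qed simp

lemma ok_iff:
  "ok xs \<longleftrightarrow> (\<forall>a b c d. a < b \<longrightarrow> b < c \<longrightarrow> c < d \<longrightarrow> d < length xs \<longrightarrow>
     \<not> (xs ! a < xs ! d \<and> xs ! b < xs ! d \<and> xs ! d < xs ! c))" (is "_ \<longleftrightarrow> ?Q xs")
proof (induction xs)
  case (Cons x xs)
  have "?Q (x # xs) \<longleftrightarrow> ?Q xs \<and> ok1 x xs"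
    unfolding ok1_iff
  proof (intro iffI conjI allI impI)
    fix a b c d assume Q: "?Q (x # xs)" and "a < b" "b < c" "c < d" "d < length xs"
    then show "\<not> (xs ! a < xs ! d \<and> xs ! b < xs ! d \<and> xs ! d < xs ! c)"
      using Q[rule_format, of "Suc a" "Suc b" "Suc c" "Suc d"] by simp
  next
    fix b c d assume Q: "?Q (x # xs)" and "b < c" "c < d" "d < length xs"
    then show "\<not> (x < xs ! d \<and> xs ! b < xs ! d \<and> xs ! d < xs ! c)"
      using Q[rule_format, of 0 "Suc b" "Suc c" "Suc d"] by simp
  next
    fix a b c d
    assume QR: "?Q xs \<and> (\<forall>b c d. b < c \<longrightarrow> c < d \<longrightarrow> d < length xs \<longrightarrow>
       \<not> (x < xs ! d \<and> xs ! b < xs ! d \<and> xs ! d < xs ! c))"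
      and *: "a < b" "b < c" "c < d" "d < length (x # xs)"
    then obtain b' c' d' where "b = Suc b'" "c = Suc c'" "d = Suc d'"
      by (metis less_nat_zero_code not0_implies_Suc)
    with QR * show "\<not> ((x # xs) ! a < (x # xs) ! d \<and> (x # xs) ! b < (x # xs) ! d \<and> (x # xs) ! d < (x # xs) ! c)"
      by (cases a) auto
  qed
  then show ?case using Cons.IH by simp
qed simp

lemma contains4_iff:
  assumes "length \<sigma> = 4"
  shows "contains \<pi> \<sigma> \<longleftrightarrow> (\<exists>a b c d. a < b \<and> b < c \<and> c < d \<and> d < length \<pi> \<and>
     (\<forall>i<4. \<forall>j<4. \<sigma> ! i < \<sigma> ! j \<longleftrightarrow> \<pi> ! ([a, b, c, d] ! i) < \<pi> ! ([a, b, c, d] ! j)))" (is "?L \<longleftrightarrow> ?R")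
proof
  assume ?L
  then obtain idx where idx: "length idx = 4" "sorted_wrt (<) idx" "\<forall>j<length idx. idx ! j < length \<pi>"
      "\<forall>a<4. \<forall>b<4. (\<sigma> ! a < \<sigma> ! b \<longleftrightarrow> \<pi> ! (idx ! a) < \<pi> ! (idx ! b))"
    using assms by (auto simp: contains_def)
  then obtain a b c d where "idx = [a, b, c, d]"
    by (auto simp: length_Suc_conv eval_nat_numeral)
  then show ?R using idx by (intro exI[of _ a] exI[of _ b] exI[of _ c] exI[of _ d]) auto
next
  assume ?R
  then obtain a b c d where *: "a < b" "b < c" "c < d" "d < length \<pi>"
     "\<forall>i<4. \<forall>j<4. \<sigma> ! i < \<sigma> ! j \<longleftrightarrow> \<pi> ! ([a, b, c, d] ! i) < \<pi> ! ([a, b, c, d] ! j)"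
    by blast
  then show ?L unfolding contains_def
    using assms by (intro exI[of _ "[a, b, c, d]"]) (auto simp: nth_Cons split: nat.splits)
qed

lemma all_less_4: "(\<forall>i<4. P i) \<longleftrightarrow> P 0 \<and> P 1 \<and> P 2 \<and> P (3::nat)"
  by (auto simp: eval_nat_numeral less_Suc_eq)

text \<open>In a configuration forbidden by \<open>ok\<close>, the order of the first two entries,
  which are distinct, tells 1243 from 2143.\<close>

lemma Av_eq: "Av = {\<pi>. is_perm \<pi> \<and> ok \<pi>}"
proof -
  have "avoids \<pi> [1,2,4,3] \<and> avoids \<pi> [2,1,4,3] \<longleftrightarrow> ok \<pi>" if "is_perm \<pi>" for \<pi>
  proof -
    have ne: "\<pi> ! a < \<pi> ! b \<or> \<pi> ! b < \<pi> ! a" if "a < b" "b < length \<pi>" for a b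
      using \<open>is_perm \<pi>\<close> that by (metis is_perm_def less_trans nat_neq_iff nth_eq_iff_index_eq)
    have c1: "contains \<pi> [1,2,4,3] \<longleftrightarrow> (\<exists>a b c d. a < b \<and> b < c \<and> c < d \<and> d < length \<pi> \<and>
        \<pi> ! a < \<pi> ! b \<and> \<pi> ! b < \<pi> ! d \<and> \<pi> ! d < \<pi> ! c)"
      by (subst contains4_iff, simp, intro iff_exI, auto simp: all_less_4)
    have c2: "contains \<pi> [2,1,4,3] \<longleftrightarrow> (\<exists>a b c d. a < b \<and> b < c \<and> c < d \<and> d < length \<pi> \<and>
        \<pi> ! b < \<pi> ! a \<and> \<pi> ! a < \<pi> ! d \<and> \<pi> ! d < \<pi> ! c)"
      by (subst contains4_iff, simp, intro iff_exI, auto simp: all_less_4)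
    show ?thesis
    proof
      assume *: "avoids \<pi> [1,2,4,3] \<and> avoids \<pi> [2,1,4,3]"
      show "ok \<pi>"
        unfolding ok_iff
      proof (intro allI impI notI)
        fix a b c d assume **: "a < b" "b < c" "c < d" "d < length \<pi>"
          "\<pi> ! a < \<pi> ! d \<and> \<pi> ! b < \<pi> ! d \<and> \<pi> ! d < \<pi> ! c"
        then consider "\<pi> ! a < \<pi> ! b" | "\<pi> ! b < \<pi> ! a"
          using ne[of a b] by linarith
        then show False
          using * ** unfolding avoids_def c1 c2 by cases blast+
      qed
    next
      assume "ok \<pi>"
      then show "avoids \<pi> [1,2,4,3] \<and> avoids \<pi> [2,1,4,3]"
        unfolding avoids_def c1 c2 ok_iff using less_trans by blast
    qed
  qed
  then show ?thesis by (auto simp: Av_def)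
qed

section \<open>The generating tree of the permutations\<close>

text \<open>Makes room for a new value \<open>v\<close> without changing the relative order of the
  others.\<close>

definition lift :: "nat \<Rightarrow> nat \<Rightarrow> nat" where
  "lift v x = (if x < v then x else Suc x)"

lemma strict_mono_lift: "strict_mono (lift v)"
  by (auto simp: strict_mono_def lift_def)

lemma lift_simps [simp]:
  "lift v x < v \<longleftrightarrow> x < v" "v < lift v x \<longleftrightarrow> v \<le> x" "lift v x \<noteq> v" "v \<noteq> lift v x"
  "lift v x = lift v y \<longleftrightarrow> x = y" "x < v \<Longrightarrow> lift v x = x"
  by (auto simp: lift_def)

lemma inj_lift: "inj (lift v)"
  by (simp add: inj_def)

lemma sorted_map_strict_mono:
  fixes f :: "nat \<Rightarrow> nat"
  assumes "strict_mono f"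
  shows "sorted (map f xs) \<longleftrightarrow> sorted xs"
  by (simp add: sorted_map strict_mono_less_eq[OF assms])

lemma sorted_filter_map:
  fixes f :: "nat \<Rightarrow> nat"
  assumes "strict_mono f" and "\<And>x. P (f x) \<longleftrightarrow> Q x"
  shows "sorted (filter P (map f xs)) \<longleftrightarrow> sorted (filter Q xs)"
  by (simp add: filter_map sorted_map_strict_mono[OF assms(1)] comp_def assms(2))

lemma sorted_filter_mono:
  assumes "sorted (filter P xs)" and "\<And>x. Q x \<Longrightarrow> P x"
  shows "sorted (filter Q xs)"
proof -
  have "filter Q xs = filter Q (filter P xs)"
    using assms(2) by (auto intro: filter_cong)
  then show ?thesis using assms(1) sorted_wrt_filter by metis
qed

lemma ok1_map:
  assumes "strict_mono f"
  shows "ok1 (f x) (map f xs) \<longleftrightarrow> ok1 x xs"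
  by (simp add: ok1_iff strict_mono_less[OF assms] cong: conj_cong)

lemma ok_map:
  assumes "strict_mono f"
  shows "ok (map f xs) \<longleftrightarrow> ok xs"
  by (induction xs) (auto simp: ok1_map[OF assms])

text \<open>Entries above both \<open>x\<close> and \<open>y\<close> are among those above
  \<open>x\<close>; hence an increasing \<open>R(x)\<close> makes \<open>x\<close> harmless as a new
  first entry.\<close>

lemma ok1_if_sorted: "sorted (filter (\<lambda>z. x < z) xs) \<Longrightarrow> ok1 x xs"
proof (induction xs)
  case (Cons y ys)
  then have s: "sorted (filter (\<lambda>z. x < z) ys)"
    by (auto split: if_splits)
  then have "sorted (filter (\<lambda>z. max x y < z) ys)"
    by (rule sorted_filter_mono) simp
  with Cons.IH[OF s] show ?case
    unfolding ok1.simps by blast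
qed simp

lemma is_perm_swap: "is_perm (a # b # xs) \<longleftrightarrow> is_perm (b # a # xs)"
proof -
  have "set (a # b # xs) = set (b # a # xs)" "length (a # b # xs) = length (b # a # xs)"
    "distinct (a # b # xs) \<longleftrightarrow> distinct (b # a # xs)"
    by auto
  then show ?thesis
    by (simp only: is_perm_def)
qed

lemma is_perm_insert:
  assumes "is_perm \<pi>" "1 \<le> v" "v \<le> Suc (length \<pi>)"
  shows "is_perm (v # map (lift v) \<pi>)"
proof -
  have "insert v (lift v ` {1..length \<pi>}) = {1..Suc (length \<pi>)}"
  proof (intro equalityI subsetI)
    fix x assume x: "x \<in> {1..Suc (length \<pi>)}"
    show "x \<in> insert v (lift v ` {1..length \<pi>})"
    proof (cases x v rule: linorder_cases)
      case less
      then have "x = lift v x" by simp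
      then show ?thesis using x less assms by (intro insertI2 image_eqI[of _ _ x]) auto
    next
      case greater
      then have "x = lift v (x - 1)" by (simp add: lift_def)
      then show ?thesis using x greater assms by (intro insertI2 image_eqI[of _ _ "x - 1"]) auto
    qed simp
  qed (use assms in \<open>auto simp: lift_def\<close>)
  then show ?thesis
    using assms inj_on_subset[OF inj_lift] by (auto simp: is_perm_def distinct_map)
qed

lemma is_perm_delete:
  assumes "is_perm (v # xs)"
  obtains \<pi> where "is_perm \<pi>" "xs = map (lift v) \<pi>" "1 \<le> v" "v \<le> Suc (length \<pi>)"
proof -
  define \<pi> where "\<pi> = map (\<lambda>x. if x < v then x else x - 1) xs"
  have d: "distinct xs" "v \<notin> set xs" and s: "insert v (set xs) = {1..Suc (length xs)}"
    using assms by (auto simp: is_perm_def)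
  have "lift v (if x < v then x else x - 1) = x" if "x \<in> set xs" for x
    using that d(2) by (cases x v rule: linorder_cases) (auto simp: lift_def)
  then have xs: "xs = map (lift v) \<pi>"
    unfolding \<pi>_def map_map by (intro map_idI[symmetric]) (auto simp: comp_def)
  have v: "1 \<le> v" "v \<le> Suc (length \<pi>)"
    using s by (auto simp: \<pi>_def)
  have "x \<in> set \<pi> \<longleftrightarrow> x \<in> {1..length \<pi>}" for x
  proof -
    have "x \<in> set \<pi> \<longleftrightarrow> lift v x \<in> insert v (set xs)"
      by (auto simp: xs)
    also have "\<dots> \<longleftrightarrow> x \<in> {1..length \<pi>}"
      unfolding s using v by (auto simp: lift_def xs)
    finally show ?thesis .
  qed
  then have "set \<pi> = {1..length \<pi>}"
    by blast
  moreover have "distinct \<pi>"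
    using d(1) unfolding xs distinct_map by blast
  ultimately have "is_perm \<pi>"
    by (simp add: is_perm_def)
  then show thesis using xs v that by blast
qed

lemma length_filter_greater:
  assumes "is_perm \<pi>"
  shows "length (filter (\<lambda>x. v < x) \<pi>) = length \<pi> - v"
proof -
  have "length (filter (\<lambda>x. v < x) \<pi>) = card (set (filter (\<lambda>x. v < x) \<pi>))"
    using assms by (intro distinct_card[symmetric]) (auto simp: is_perm_def)
  also have "set (filter (\<lambda>x. v < x) \<pi>) = {Suc v..length \<pi>}"
    using assms by (auto simp: is_perm_def)
  finally show ?thesis by simp
qed

section \<open>The two kinds of insertion\<close>

definition ins1 :: "nat \<Rightarrow> nat list \<Rightarrow> nat list" where
  "ins1 v \<pi> = v # map (lift v) \<pi>"

text \<open>The first entry stays unlifted because the values inserted here exceed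
  \<open>hd \<pi>\<close>.\<close>

definition ins2 :: "nat \<Rightarrow> nat list \<Rightarrow> nat list" where
  "ins2 v \<pi> = hd \<pi> # v # map (lift v) (tl \<pi>)"

text \<open>Says that \<open>R(hd \<pi>)\<close> is increasing; on the result of a step it tells
  front insertion (true) from second-place insertion (false).\<close>

definition rising :: "nat list \<Rightarrow> bool" where
  "rising \<pi> \<longleftrightarrow> sorted (filter (\<lambda>x. hd \<pi> < x) (tl \<pi>))"

text \<open>The first \<open>w \<ge> 1\<close> for which inserting \<open>w\<close> in front keeps \<open>R(w)\<close> increasing is \<open>hd \<pi>\<close> if \<open>\<pi>\<close> is
  rising, and \<open>base \<pi>\<close> otherwise. The rising case has this one additional front insertion, and in
  exchange loses the second-place insertion of \<open>Suc (hd \<pi>)\<close>, which would be rising again.\<close>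

definition base :: "nat list \<Rightarrow> nat" where
  "base \<pi> = (if rising \<pi> then Suc (hd \<pi>) else \<pi> ! 1)"

definition pdepth :: "nat list \<Rightarrow> nat" where
  "pdepth \<pi> = Suc (length \<pi>) - base \<pi>"

text \<open>Here \<open>j\<close> counts the entries that are at least \<open>v\<close>. If
  \<open>u\<close> holds, the chain through the new entry has length \<open>j + 2\<close>: either
  \<open>hd \<pi>\<close> precedes \<open>v\<close>, or the substitute
  \<open>hd \<pi> = v - 1\<close> in front has one more entry above it.\<close>

definition pstep :: "nat \<Rightarrow> bool \<Rightarrow> nat list \<Rightarrow> nat list" where
  "pstep j u \<pi> = (let v = Suc (length \<pi>) - j in
     if \<not> u then ins1 v \<pi>
     else if v = base \<pi> \<and> rising \<pi> then ins1 (hd \<pi>) \<pi>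
     else ins2 v \<pi>)"

text \<open>The empty permutation is set aside as the partner of the term 1.\<close>

definition Av1 :: "nat list set" where
  "Av1 = {\<pi>. is_perm \<pi> \<and> ok \<pi> \<and> \<pi> \<noteq> []}"

text \<open>The entries after \<open>q\<close> and above both \<open>p\<close> and \<open>q\<close>
  increase. So \<open>q < p\<close> would make \<open>\<pi>\<close> rising, and so would
  \<open>q = Suc p\<close>, as then \<open>q\<close> is the least entry above \<open>p\<close> and
  comes first among them.\<close>

lemma not_rising_cases:
  assumes "\<pi> \<in> Av1" "\<not> rising \<pi>"
  obtains p q ys where "\<pi> = p # q # ys" "Suc p < q" "sorted (filter (\<lambda>x. q < x) ys)"
proof -
  obtain p q ys where \<pi>: "\<pi> = p # q # ys"
    using assms by (cases \<pi> rule: remdups_adj.cases) (auto simp: Av1_def rising_def)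
  have "ok1 p (q # ys)" and "distinct (p # q # ys)"
    using assms unfolding Av1_def \<pi> is_perm_def ok.simps by auto
  then have s: "sorted (filter (\<lambda>x. max p q < x) ys)"
    unfolding ok1.simps by blast
  have "p < q"
  proof (rule ccontr)
    assume "\<not> p < q"
    with s have "rising \<pi>" by (simp add: rising_def \<pi> max_absorb1)
    with assms show False by simp
  qed
  then have s': "sorted (filter (\<lambda>x. q < x) ys)"
    using s by (simp add: max_absorb2)
  have "q \<noteq> Suc p"
  proof
    assume "q = Suc p"
    moreover from this have "filter (\<lambda>x. p < x) ys = filter (\<lambda>x. q < x) ys"
      using \<open>distinct (p # q # ys)\<close> by (intro filter_cong) (auto intro!: Suc_lessI)
    ultimately have "rising \<pi>" using s' by (auto simp: rising_def \<pi>)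
    with assms show False by simp
  qed
  with \<open>p < q\<close> have "Suc p < q" by simp
  then show thesis by (rule that[OF \<pi> _ s'])
qed

lemma Av1_bounds:
  assumes "\<pi> \<in> Av1"
  shows "1 \<le> hd \<pi>" "hd \<pi> < base \<pi>" "base \<pi> \<le> Suc (length \<pi>)"
proof -
  have set: "set \<pi> = {1..length \<pi>}" "\<pi> \<noteq> []"
    using assms by (auto simp: Av1_def is_perm_def)
  then have "hd \<pi> \<in> {1..length \<pi>}"
    by (metis hd_in_set)
  then show "1 \<le> hd \<pi>" by simp
  show "hd \<pi> < base \<pi>" "base \<pi> \<le> Suc (length \<pi>)"
  proof (atomize (full), cases "rising \<pi>")
    case True
    then show "hd \<pi> < base \<pi> \<and> base \<pi> \<le> Suc (length \<pi>)"
      using \<open>hd \<pi> \<in> _\<close> by (simp add: base_def)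
  next
    case False
    with assms obtain p q ys where \<pi>: "\<pi> = p # q # ys" "Suc p < q"
      by (elim not_rising_cases)
    then have "q \<in> set \<pi>" by simp
    then have "q \<in> {1..length \<pi>}" unfolding set(1) .
    with False \<pi> show "hd \<pi> < base \<pi> \<and> base \<pi> \<le> Suc (length \<pi>)"
      by (simp add: base_def)
  qed
qed

text \<open>Decides when \<open>w\<close> may be inserted with \<open>R(w)\<close> increasing;
  \<open>w <= x\<close> refers to old values, as \<open>lift w\<close> moves \<open>w\<close> itself
  up. In the rising case a smaller \<open>w\<close> already occurs after \<open>hd \<pi>\<close> and
  gives a descent.\<close>

lemma sorted_top_iff:
  assumes "\<pi> \<in> Av1" "1 \<le> w"
  shows "sorted (filter (\<lambda>x. w \<le> x) \<pi>) \<longleftrightarrow> (if rising \<pi> then hd \<pi> \<le> w else base \<pi> \<le> w)"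
proof (cases "rising \<pi>")
  case True
  obtain p xs where \<pi>: "\<pi> = p # xs"
    using assms by (cases \<pi>) (auto simp: Av1_def)
  have d: "distinct (p # xs)" and set: "insert p (set xs) = {1..Suc (length xs)}"
    using assms by (auto simp: Av1_def is_perm_def \<pi>)
  have "sorted (filter (\<lambda>x. w \<le> x) \<pi>) \<longleftrightarrow> p \<le> w"
  proof
    assume s: "sorted (filter (\<lambda>x. w \<le> x) \<pi>)"
    show "p \<le> w"
    proof (rule ccontr)
      assume "\<not> p \<le> w"
      moreover from this have "w \<in> set xs"
        using assms(2) set
        by (metis atLeastAtMost_iff insertE insertI1 le_trans linorder_linear order_refl)
      ultimately show False using s by (auto simp: \<pi>)
    qed
  next
    assume "p \<le> w"
    have "sorted (filter (\<lambda>x. p \<le> x) \<pi>)"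
    proof -
      have "filter (\<lambda>x. p \<le> x) xs = filter (\<lambda>x. p < x) xs"
        using d by (intro filter_cong) (auto simp: le_less)
      then show ?thesis using True by (auto simp: rising_def \<pi>)
    qed
    then show "sorted (filter (\<lambda>x. w \<le> x) \<pi>)"
      by (rule sorted_filter_mono) (use \<open>p \<le> w\<close> in simp)
  qed
  then show ?thesis using True by (simp add: \<pi>)
next
  case False
  with assms obtain p q ys where \<pi>: "\<pi> = p # q # ys" "Suc p < q" "sorted (filter (\<lambda>x. q < x) ys)"
    by (elim not_rising_cases)
  have d: "distinct (p # q # ys)" and set: "insert p (insert q (set ys)) = {1..length \<pi>}"
    using assms by (auto simp: Av1_def is_perm_def \<pi>)
  have "sorted (filter (\<lambda>x. w \<le> x) \<pi>) \<longleftrightarrow> q \<le> w"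
  proof
    assume s: "sorted (filter (\<lambda>x. w \<le> x) \<pi>)"
    show "q \<le> w"
    proof (rule ccontr)
      assume "\<not> q \<le> w"
      have "q \<in> insert p (insert q (set ys))" by simp
      then have "q \<in> {1..length \<pi>}" unfolding set .
      \<comment> \<open>As \<open>Suc p < q\<close>, the value \<open>q - 1\<close> is neither
        \<open>p\<close> nor \<open>q\<close>, so it stands after \<open>q\<close> and forms a
        descent with it.\<close>
      with \<pi> have "q - 1 \<in> insert p (insert q (set ys))" unfolding set by auto
      then have "q - 1 \<in> set ys" using \<pi>(2) by auto
      with s \<open>\<not> q \<le> w\<close> \<pi>(2) show False by (auto simp: \<pi>(1) split: if_splits)
    qed
  next
    assume "q \<le> w"
    have "sorted (filter (\<lambda>x. q \<le> x) \<pi>)"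
    proof -
      have "filter (\<lambda>x. q \<le> x) ys = filter (\<lambda>x. q < x) ys"
        using d by (intro filter_cong) (auto simp: le_less)
      then show ?thesis using \<pi>(2,3) by (auto simp: \<pi>(1))
    qed
    then show "sorted (filter (\<lambda>x. w \<le> x) \<pi>)"
      by (rule sorted_filter_mono) (use \<open>q \<le> w\<close> in simp)
  qed
  then show ?thesis using False by (simp add: base_def \<pi>(1))
qed

text \<open>A new subsequence is \<open>v\<close> followed by any \<open>k\<close> entries of the
  chain \<open>R(v)\<close>.\<close>

lemma tau_ins1:
  assumes "is_perm \<pi>" "1 \<le> v" "v \<le> Suc (length \<pi>)" "sorted (filter (\<lambda>x. v \<le> x) \<pi>)"
  shows "tau (Suc k) (ins1 v \<pi>) = tau (Suc k) \<pi> + (Suc (length \<pi>) - v choose k)"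
proof -
  have perm: "is_perm (v # map (lift v) \<pi>)" by (rule is_perm_insert) fact+
  have "sorted (filter (\<lambda>x. v < x) (map (lift v) \<pi>))"
    using assms(4) by (subst sorted_filter_map[OF strict_mono_lift]) auto
  then have "chains k v (map (lift v) \<pi>) = length (filter (\<lambda>x. v < x) (map (lift v) \<pi>)) choose k"
    using perm by (intro chains_sorted) (auto simp: is_perm_def)
  also have "length (filter (\<lambda>x. v < x) (map (lift v) \<pi>)) = Suc (length \<pi>) - v"
    using length_filter_greater[OF perm, of v] by simp
  finally have "chains k v (map (lift v) \<pi>) = Suc (length \<pi>) - v choose k" .
  moreover have "chains (Suc k) 0 (map (lift v) \<pi>) = chains (Suc k) 0 \<pi>"
    using chains_map[OF strict_mono_lift, of "Suc k" v 0 \<pi>] assms(2) by simp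
  ultimately show ?thesis
    using assms perm by (simp add: tau_eq_chains ins1_def is_perm_def)
qed

lemma is_perm_ins2:
  assumes "is_perm \<pi>" "\<pi> \<noteq> []" "hd \<pi> < v" "v \<le> Suc (length \<pi>)"
  shows "is_perm (ins2 v \<pi>)"
proof -
  obtain p xs where \<pi>: "\<pi> = p # xs" using assms(2) by (cases \<pi>) auto
  have "is_perm (v # map (lift v) \<pi>)"
    using assms by (intro is_perm_insert) auto
  then show ?thesis
    using assms(3) by (simp add: \<pi> ins2_def is_perm_swap)
qed

text \<open>The only entry before \<open>v\<close> is \<open>hd \<pi>\<close>, and it is smaller.
  Pascal's rule adds the new subsequences with and without it.\<close>

lemma tau_ins2:
  assumes "is_perm \<pi>" "\<pi> \<noteq> []" "hd \<pi> < v" "v \<le> Suc (length \<pi>)" "sorted (filter (\<lambda>x. v \<le> x) \<pi>)"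
  shows "tau (Suc k) (ins2 v \<pi>) = tau (Suc k) \<pi> + (Suc (Suc (length \<pi>) - v) choose k)"
proof -
  obtain p xs where \<pi>: "\<pi> = p # xs" using assms(2) by (cases \<pi>) auto
  define ys where "ys = map (lift v) xs"
  have perm: "is_perm (p # v # ys)" and "p < v"
    using is_perm_ins2[OF assms(1-4)] assms(3) by (auto simp: ins2_def \<pi> ys_def)
  have "sorted (filter (\<lambda>x. v < x) ys)"
    using assms(5) \<open>p < v\<close> unfolding ys_def by (subst sorted_filter_map[OF strict_mono_lift]) (auto simp: \<pi>)
  then have "chains i v ys = length (filter (\<lambda>x. v < x) ys) choose i" for i
    using perm by (intro chains_sorted) (auto simp: is_perm_def)
  moreover have "length (filter (\<lambda>x. v < x) ys) = Suc (length \<pi>) - v"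
    using length_filter_greater[OF perm, of v] \<open>p < v\<close> by (simp add: \<pi> ys_def)
  ultimately have v: "chains i v ys = Suc (length \<pi>) - v choose i" for i
    by simp
  have "chains i 0 ys = chains i 0 xs" "chains i p ys = chains i p xs" for i
    using chains_map[OF strict_mono_lift, of i v 0 xs] chains_map[OF strict_mono_lift, of i v p xs] \<open>p < v\<close>
    by (simp_all add: ys_def)
  moreover have "\<forall>x\<in>set \<pi>. 0 < x" "\<forall>x\<in>set (p # v # ys). 0 < x"
    using assms(1) perm unfolding is_perm_def by auto
  ultimately show ?thesis
    using v \<open>p < v\<close> unfolding ins2_def by (cases k) (simp_all add: tau_eq_chains \<pi> flip: ys_def)
qed

lemma ins1_props:
  assumes "\<pi> \<in> Av1" "1 \<le> v" "v \<le> Suc (length \<pi>)" "sorted (filter (\<lambda>x. v \<le> x) \<pi>)"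
  shows "ins1 v \<pi> \<in> Av1" "rising (ins1 v \<pi>)" "pdepth (ins1 v \<pi>) = Suc (length \<pi>) - v"
proof -
  have s: "sorted (filter (\<lambda>x. v < x) (map (lift v) \<pi>))"
    using assms(4) by (subst sorted_filter_map[OF strict_mono_lift]) auto
  then show r: "rising (ins1 v \<pi>)" by (simp add: rising_def ins1_def)
  then show "pdepth (ins1 v \<pi>) = Suc (length \<pi>) - v"
    by (simp add: pdepth_def base_def ins1_def)
  show "ins1 v \<pi> \<in> Av1"
    using assms s by (simp add: Av1_def ins1_def is_perm_insert ok_map strict_mono_lift ok1_if_sorted)
qed

lemma ins2_props:
  assumes "\<pi> \<in> Av1" "base \<pi> \<le> v" "v \<le> Suc (length \<pi>)" "\<not> (v = base \<pi> \<and> rising \<pi>)"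
  shows "ins2 v \<pi> \<in> Av1" "\<not> rising (ins2 v \<pi>)" "pdepth (ins2 v \<pi>) = Suc (Suc (length \<pi>) - v)"
proof -
  obtain p xs where \<pi>: "\<pi> = p # xs"
    using assms by (cases \<pi>) (auto simp: Av1_def)
  have "p < v" "1 \<le> p" using Av1_bounds[OF assms(1)] assms(2) by (auto simp: \<pi>)
  then have "sorted (filter (\<lambda>x. v \<le> x) \<pi>)"
    using sorted_top_iff[OF assms(1), of v] assms(2) by (auto simp: \<pi>)
  then have s: "sorted (filter (\<lambda>x. v < x) (map (lift v) xs))"
    using \<open>p < v\<close> by (subst sorted_filter_map[OF strict_mono_lift]) (auto simp: \<pi>)
  have lift_p: "p < lift v x \<longleftrightarrow> p < x" for x
    using \<open>p < v\<close> by (auto simp: lift_def)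
  show nr: "\<not> rising (ins2 v \<pi>)"
  proof
    assume "rising (ins2 v \<pi>)"
    then have s': "sorted (filter (\<lambda>x. p < x) (map (lift v) xs))"
      and ge: "\<forall>x\<in>set xs. p < x \<longrightarrow> v \<le> lift v x"
      using \<open>p < v\<close> by (auto simp: rising_def ins2_def \<pi> lift_p)
    have "sorted (filter (\<lambda>x. p < x) (map (lift v) xs)) \<longleftrightarrow> sorted (filter (\<lambda>x. p < x) xs)"
      by (rule sorted_filter_map[OF strict_mono_lift]) (rule lift_p)
    with s' have "rising \<pi>" by (simp add: rising_def \<pi>)
    with assms(2,4) have "Suc p < v" by (simp add: base_def \<pi>)
    \<comment> \<open>The value \<open>Suc p\<close> stands to the right of \<open>v\<close> and
      below it, so \<open>R(p)\<close> contains a descent.\<close>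
    then have "Suc p \<in> insert p (set xs)"
      using assms by (simp add: \<pi> Av1_def is_perm_def)
    then have "v \<le> lift v (Suc p)" using ge by auto
    with \<open>Suc p < v\<close> show False by (simp add: lift_def)
  qed
  then show "pdepth (ins2 v \<pi>) = Suc (Suc (length \<pi>) - v)"
    using assms(3) by (auto simp: pdepth_def base_def ins2_def \<pi>)
  have "ok (map (lift v) (p # xs))"
    using assms(1) by (simp add: Av1_def \<pi> ok_map strict_mono_lift del: list.map)
  then have "ok (map (lift v) xs)" "ok1 p (map (lift v) xs)"
    using \<open>p < v\<close> by auto
  then have "ok (ins2 v \<pi>)"
    using s \<open>p < v\<close> by (simp add: ins2_def \<pi> ok1_if_sorted max_absorb2)
  then show "ins2 v \<pi> \<in> Av1"
    using assms \<open>p < v\<close> is_perm_ins2[of \<pi> v] by (simp add: Av1_def \<pi> ins2_def)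
qed

text \<open>Merges the substitute front insertion with the regular ones. There \<open>u\<close> can
  be read off from \<open>v = hd \<pi>\<close>, since regular values are at least
  \<open>base \<pi>\<close>, hence above \<open>hd \<pi>\<close>.\<close>

lemma pstep_cases:
  assumes "\<pi> \<in> Av1" "j \<le> pdepth \<pi>"
  obtains v where "pstep j u \<pi> = ins1 v \<pi>" "1 \<le> v" "v \<le> Suc (length \<pi>)"
      "sorted (filter (\<lambda>x. v \<le> x) \<pi>)" "j + of_bool u = Suc (length \<pi>) - v" "u \<longleftrightarrow> v = hd \<pi>"
  | v where "pstep j u \<pi> = ins2 v \<pi>" "base \<pi> \<le> v" "v \<le> Suc (length \<pi>)"
      "\<not> (v = base \<pi> \<and> rising \<pi>)" "j = Suc (length \<pi>) - v" "u"
proof -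
  define v where "v = Suc (length \<pi>) - j"
  note b = Av1_bounds[OF assms(1)]
  have v: "base \<pi> \<le> v" "v \<le> Suc (length \<pi>)" "j = Suc (length \<pi>) - v"
    using assms(2) b by (auto simp: v_def pdepth_def)
  consider "\<not> u" | "u" "v = base \<pi>" "rising \<pi>" | "u" "\<not> (v = base \<pi> \<and> rising \<pi>)" by blast
  then show thesis
  proof cases
    case 1
    then show thesis
      using v b sorted_top_iff[OF assms(1), of v]
      by (intro that(1)[of v]) (auto simp: pstep_def Let_def v_def[symmetric])
  next
    case 2
    then show thesis
      using v b sorted_top_iff[OF assms(1), of "hd \<pi>"]
      by (intro that(1)[of "hd \<pi>"]) (auto simp: pstep_def Let_def v_def[symmetric] base_def)
  next
    case 3
    then show thesis
      using v b by (intro that(2)[of v]) (auto simp: pstep_def Let_def v_def[symmetric])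
  qed
qed

lemma pstep_props:
  assumes "\<pi> \<in> Av1" "j \<le> pdepth \<pi>"
  shows "pstep j u \<pi> \<in> Av1 \<and> pdepth (pstep j u \<pi>) = j + of_bool u \<and>
    length (pstep j u \<pi>) = Suc (length \<pi>) \<and>
    tau (Suc k) (pstep j u \<pi>) = tau (Suc k) \<pi> + (j + of_bool u choose k)"
  using assms
proof (cases rule: pstep_cases[where u = u])
  case (1 v)
  then show ?thesis
    using assms ins1_props[of \<pi> v] tau_ins1[of \<pi> v k] by (simp add: Av1_def ins1_def)
next
  case (2 v)
  then have "sorted (filter (\<lambda>x. v \<le> x) \<pi>)" "hd \<pi> < v"
    using sorted_top_iff[OF assms(1), of v] Av1_bounds[OF assms(1)] by auto
  with 2 show ?thesis
    using assms ins2_props[of \<pi> v] tau_ins2[of \<pi> v k] by (auto simp: Av1_def ins2_def)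
qed

section \<open>Invertibility of the steps\<close>

lemma ins1_inj: "ins1 v \<pi> = ins1 v' \<pi>' \<Longrightarrow> v = v' \<and> \<pi> = \<pi>'"
  by (auto simp: ins1_def inj_lift inj_map_eq_map)

lemma ins2_inj:
  "\<pi> \<noteq> [] \<Longrightarrow> \<pi>' \<noteq> [] \<Longrightarrow> ins2 v \<pi> = ins2 v' \<pi>' \<Longrightarrow> v = v' \<and> \<pi> = \<pi>'"
  by (cases \<pi>; cases \<pi>') (auto simp: ins2_def inj_lift inj_map_eq_map)

text \<open>Whether the result is rising reveals the kind of insertion, and each kind is
  injective.\<close>

lemma pstep_inj:
  assumes "\<pi> \<in> Av1" "j \<le> pdepth \<pi>" "\<pi>' \<in> Av1" "j' \<le> pdepth \<pi>'" "pstep j u \<pi> = pstep j' u' \<pi>'"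
  shows "j = j' \<and> u = u' \<and> \<pi> = \<pi>'"
  using assms(1,2)
proof (cases rule: pstep_cases[where u = u])
  case 1: (1 v)
  show ?thesis
    using assms(3,4)
  proof (cases rule: pstep_cases[where u = u'])
    case (1 v')
    then have "v = v'" "\<pi> = \<pi>'" using ins1_inj \<open>pstep j u \<pi> = ins1 v \<pi>\<close> assms(5) by metis+
    with 1 \<open>j + of_bool u = _\<close> \<open>u \<longleftrightarrow> _\<close> show ?thesis by auto
  next
    case (2 v')
    then show ?thesis
      using ins1_props(2)[of \<pi> v] ins2_props(2)[of \<pi>' v'] 1 assms by simp
  qed
next
  case 2: (2 v)
  show ?thesis
    using assms(3,4)
  proof (cases rule: pstep_cases[where u = u'])
    case (1 v')
    then show ?thesis
      using ins2_props(2)[of \<pi> v] ins1_props(2)[of \<pi>' v'] 2 assms by simp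
  next
    case (2 v')
    then have "v = v'" "\<pi> = \<pi>'"
      using ins2_inj[of \<pi> \<pi>' v v'] \<open>pstep j u \<pi> = ins2 v \<pi>\<close> assms by (auto simp: Av1_def)
    with 2 \<open>j = _\<close> \<open>u\<close> show ?thesis by auto
  qed
qed

lemma pstep_surj:
  assumes "\<pi> \<in> Av1" "\<pi> \<noteq> [Suc 0]"
  shows "\<exists>\<pi>' j u. \<pi>' \<in> Av1 \<and> j \<le> pdepth \<pi>' \<and> \<pi> = pstep j u \<pi>' \<and> length \<pi>' < length \<pi>"
proof (cases "rising \<pi>")
  case True
  obtain v xs where \<pi>: "\<pi> = v # xs"
    using assms by (cases \<pi>) (auto simp: Av1_def)
  obtain \<pi>' where \<pi>': "is_perm \<pi>'" "xs = map (lift v) \<pi>'" "1 \<le> v" "v \<le> Suc (length \<pi>')"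
    using assms is_perm_delete[of v xs] by (auto simp: Av1_def \<pi>)
  have "\<pi>' \<noteq> []"
    using \<pi>' assms by (auto simp: \<pi>)
  then have Av: "\<pi>' \<in> Av1"
    using assms \<pi>' by (simp add: Av1_def \<pi> ok_map strict_mono_lift)
  have "sorted (filter (\<lambda>x. v < x) (map (lift v) \<pi>'))"
    using True by (simp add: rising_def \<pi> \<pi>'(2))
  then have "sorted (filter (\<lambda>x. v \<le> x) \<pi>')"
    by (subst (asm) sorted_filter_map[OF strict_mono_lift, where Q = "\<lambda>x. v \<le> x"]) auto
  \<comment> \<open>The second case undoes the substitute front insertion.\<close>
  then consider "base \<pi>' \<le> v" | "rising \<pi>'" "v = hd \<pi>'"
    using sorted_top_iff[OF Av \<pi>'(3)]
    by (cases "rising \<pi>'"; cases "v = hd \<pi>'") (auto simp: base_def)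
  then show ?thesis
  proof cases
    case 1
    then show ?thesis
      using Av \<pi>' by (intro exI[of _ \<pi>'] exI[of _ "Suc (length \<pi>') - v"] exI[of _ False])
        (auto simp: pdepth_def pstep_def \<pi> ins1_def)
  next
    case 2
    then show ?thesis
      using Av \<pi>' Av1_bounds[OF Av] by (intro exI[of _ \<pi>'] exI[of _ "pdepth \<pi>'"] exI[of _ True])
        (auto simp: pdepth_def pstep_def \<pi> ins1_def)
  qed
next
  case False
  with assms obtain p v ys where \<pi>: "\<pi> = p # v # ys" "Suc p < v" "sorted (filter (\<lambda>x. v < x) ys)"
    by (elim not_rising_cases)
  have "is_perm (v # p # ys)"
    using assms by (simp add: Av1_def \<pi> is_perm_swap)
  then obtain \<pi>' where \<pi>': "is_perm \<pi>'" "p # ys = map (lift v) \<pi>'" "1 \<le> v" "v \<le> Suc (length \<pi>')"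
    by (elim is_perm_delete)
  then obtain p' xs where p': "\<pi>' = p' # xs" "p = lift v p'" "ys = map (lift v) xs"
    by (cases \<pi>') auto
  have "p' = p" using p'(2) \<pi>(2) by (simp add: lift_def split: if_splits)
  with p' have \<pi>'_eq: "\<pi>' = p # xs" "ys = map (lift v) xs" by blast+
  have "ok (p # ys)"
    using assms by (simp add: Av1_def \<pi>(1))
  then have "ok \<pi>'"
    unfolding \<pi>'(2) by (simp only: ok_map[OF strict_mono_lift])
  then have Av: "\<pi>' \<in> Av1"
    using \<pi>'(1) \<pi>'_eq(1) by (simp add: Av1_def)
  have "sorted (filter (\<lambda>x. v < x) (map (lift v) \<pi>'))"
    using \<pi>(2,3) by (simp flip: \<pi>'(2))
  then have "sorted (filter (\<lambda>x. v \<le> x) \<pi>')"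
    by (subst (asm) sorted_filter_map[OF strict_mono_lift, where Q = "\<lambda>x. v \<le> x"]) auto
  \<comment> \<open>Equality with the base of a rising parent would give \<open>v = Suc p\<close>,
    contrary to \<open>Suc p < v\<close>.\<close>
  then have "base \<pi>' \<le> v" "\<not> (v = base \<pi>' \<and> rising \<pi>')"
    using sorted_top_iff[OF Av \<pi>'(3)] \<pi>(2) by (auto simp: base_def \<pi>'_eq split: if_splits)
  then show ?thesis
    using Av \<pi>'(4) \<pi>(1) \<pi>'_eq by (intro exI[of _ \<pi>'] exI[of _ "Suc (length \<pi>') - v"] exI[of _ True])
        (auto simp: pdepth_def pstep_def ins2_def)
qed

interpretation perm: generating_tree Av1 "[Suc 0]" pstep pdepth length
proof
  show "[Suc 0] \<in> Av1" by (simp add: Av1_def is_perm_def)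
  show "pdepth [Suc 0] = 0" by (simp add: pdepth_def base_def rising_def)
next
  fix x j u assume *: "x \<in> Av1" "j \<le> pdepth x"
  show "pstep j u x \<in> Av1 \<and> pdepth (pstep j u x) = j + of_bool u"
    using pstep_props[OF *] by simp
  have "length (pstep j u x) \<noteq> length [Suc 0]"
    using pstep_props[OF *, of u] * by (simp add: Av1_def)
  then show "pstep j u x \<noteq> [Suc 0]" by metis
next
  show "j = j' \<and> u = u' \<and> x = x'"
    if "x \<in> Av1" "j \<le> pdepth x" "x' \<in> Av1" "j' \<le> pdepth x'" "pstep j u x = pstep j' u' x'"
    for x j x' j' u u'
    using that by (rule pstep_inj)
next
  show "\<exists>y j u. y \<in> Av1 \<and> j \<le> pdepth y \<and> x = pstep j u y \<and> length y < length x"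
    if "x \<in> Av1" "x \<noteq> [Suc 0]" for x
    using pstep_surj that by simp
qed

section \<open>Weights of permutations in terms of words\<close>

abbreviation perm_of :: "(nat \<times> bool) list \<Rightarrow> nat list" where
  "perm_of \<equiv> build [Suc 0] pstep"

lemma length_perm_of: "valid w \<Longrightarrow> length (perm_of w) = length (labels w)"
proof (induction w rule: valid.induct)
  case (2 j u w)
  then show ?case
    using perm.build_in[of w] pstep_props[of "perm_of w" j u] by simp
qed simp

lemma tau_perm_of: "valid w \<Longrightarrow> tau (Suc k) (perm_of w) = (\<Sum>l\<leftarrow>labels w. (l - 1) choose k)"
proof (induction w rule: valid.induct)
  case 1
  then show ?case by (cases k) (simp_all add: tau_eq_chains)
next
  case (2 j u w)
  then show ?case
    using perm.build_in[of w] pstep_props[of "perm_of w" j u k] by simp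
qed

lemma F_weight_perm_of:
  assumes "valid w" "n > 0"
  shows "F_weight A (perm_of w) n = (\<Sum>l\<leftarrow>labels w. mat_mult Bmat A l n)"
proof -
  define N where "N = length (labels w)"
  \<comment> \<open>Stated for arbitrary \<open>ls\<close> with \<open>N\<close> fixed, so that the
    summation range does not shrink in the induction.\<close>
  have eq: "(\<Sum>k<N. A (Suc k) n * int (\<Sum>l\<leftarrow>ls. (l - 1) choose k)) = (\<Sum>l\<leftarrow>ls. mat_mult Bmat A l n)"
    if "\<forall>l\<in>set ls. 1 \<le> l \<and> l \<le> N" for ls
    using that
  proof (induction ls)
    case (Cons l ls)
    then obtain m where l: "l = Suc m" by (cases l) auto
    have "(\<Sum>k<N. A (Suc k) n * int (m choose k)) = (\<Sum>k\<le>m. A (Suc k) n * int (m choose k))"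
      using Cons.prems l by (intro sum.mono_neutral_right) (auto simp: binomial_eq_0)
    then have "(\<Sum>k<N. A (Suc k) n * int (m choose k)) = mat_mult Bmat A l n"
      by (simp add: mat_mult_Bmat l mult.commute)
    with Cons l show ?case by (simp add: distrib_left sum.distrib)
  qed simp
  have "F_weight A (perm_of w) n = (\<Sum>k<N. A (Suc k) n * int (tau (Suc k) (perm_of w)))"
    using assms by (simp add: F_weight_def length_perm_of N_def sum.atLeast1_atMost_eq)
  also have "\<dots> = (\<Sum>l\<leftarrow>labels w. mat_mult Bmat A l n)"
    unfolding tau_perm_of[OF assms(1)]
    using labels_ge_1 labels_le_length(2)[OF assms(1)] by (intro eq) (auto simp: N_def)
  finally show ?thesis .
qed

section \<open>The main theorem\<close>

text \<open>On each fibre of the common weight, the inverse of one bijection composes with the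
  other.\<close>

lemma formal_eq_if_bij_betw:
  assumes f: "bij_betw f Z X" and g: "bij_betw g Z Y" and w: "\<And>z. z \<in> Z \<Longrightarrow> w (f z) = v (g z)"
  shows "formal_eq X w Y v"
  unfolding formal_eq_def
proof
  fix e
  have "bij_betw f {z \<in> Z. w (f z) = e} {x \<in> X. w x = e}"
    using f by (auto simp: bij_betw_def inj_on_def)
  moreover have "bij_betw g {z \<in> Z. w (f z) = e} {y \<in> Y. v y = e}"
    using g w by (auto simp: bij_betw_def inj_on_def)
  ultimately show "{x \<in> X. w x = e} \<approx> {y \<in> Y. v y = e}"
    unfolding eqpoll_def by (meson bij_betw_inv_into bij_betw_trans)
qed

text \<open>Only rows from 1 on are compared, because \<open>B (B^-1 A)\<close> need not agree with
  \<open>A\<close> in the meaningless row 0.\<close>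

lemma F_eq_C_if:
  assumes "\<And>l n. A' (Suc l) n = mat_mult Bmat A (Suc l) n"
  shows "F_eq_C A A'"
proof -
  \<comment> \<open>\<open>None\<close> stands for the empty permutation and for the term 1.\<close>
  let ?Z = "insert None (Some ` {w. valid w})"
  have Av: "Av = insert [] Av1"
    by (auto simp: Av_eq Av1_def is_perm_def)
  have "\<forall>w. valid w \<longrightarrow> perm_of w \<noteq> []"
    using perm.build_in by (auto simp: Av1_def)
  then have "bij_betw (case_option [] perm_of) ?Z Av"
    using perm.build_inj perm.build_in bij_betw_imp_surj_on[OF perm.bij_betw_build]
    unfolding Av bij_betw_def inj_on_def by (auto simp: image_image)
  moreover have "bij_betw (map_option cf_of) ?Z UNIV"
  proof -
    have "range Some = Some ` cf_of ` {w. valid w}"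
      using cf.bij_betw_build by (simp add: bij_betw_def)
    then have "insert None (Some ` cf_of ` {w. valid w}) = UNIV"
      by (metis UNIV_option_conv)
    then show ?thesis
      using cf.bij_betw_build by (auto simp: bij_betw_def inj_on_def image_image)
  qed
  moreover have "F_weight A (case_option [] perm_of z) = C_weight A' (map_option cf_of z)"
    if "z \<in> ?Z" for z
  proof
    fix n
    show "F_weight A (case_option [] perm_of z) n = C_weight A' (map_option cf_of z) n"
    proof (cases "n = 0 \<or> z = None")
      case True
      then show ?thesis by (auto simp: F_weight_def C_weight_def C_mexp_def)
    next
      case False
      with that obtain w where w: "z = Some w" "valid w" by auto
      have "A' l n = mat_mult Bmat A l n" if "l \<in> set (labels w)" for l
        using assms[of "l - 1"] labels_ge_1[OF that] by simp
      then have "map (\<lambda>l. mat_mult Bmat A l n) (labels w) = map (\<lambda>l. A' l n) (labels w)"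
        by simp
      with w False show ?thesis by (simp add: F_weight_perm_of C_weight_cf_of del: map_eq_conv)
    qed
  qed
  ultimately show ?thesis
    unfolding F_eq_C_def by (rule formal_eq_if_bij_betw)
qed

theorem mainTheorem2:
  shows "(\<forall>A\<in>matA. F_eq_C A (mat_mult Bmat A) \<and> F_eq_C (mat_mult Binv A) A)
       \<and> (\<forall>A'\<in>matA. \<exists>A\<in>matA. F_eq_C A A')
       \<and> (\<forall>A\<in>matA. \<exists>A'\<in>matA. F_eq_C A A')"
proof -
  have B: "F_eq_C A (mat_mult Bmat A)" for A
    by (rule F_eq_C_if) simp
  have Binv: "F_eq_C (mat_mult Binv A) A" for A
    by (rule F_eq_C_if) (simp add: mat_mult_Bmat_Binv)
  \<comment> \<open>These provide the witnesses \<open>B^-1 A'\<close> and \<open>B A\<close> for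
    the two existence claims.\<close>
  have "mat_mult Bmat A \<in> matA" "mat_mult Binv A \<in> matA" if "A \<in> matA" for A
    using that by (rule matA_combination, simp add: mat_mult_Bmat mat_mult_Binv)+
  then show ?thesis using B Binv by blast
qed

end
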